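(* Let $x\ge 1$ be real, let $l\ge 2$ be an integer, put $t=\lfloor \log_l x\rfloor$, and let $j$ be an integer with $0\le j\le t-1$. Define $$\tau=\tau(x,j,l)=\min\left(t-j,\ \left\lceil \frac{\{\log_l x\}\log l+j\log l}{\log(l+1)-\log l}\right\rceil\right),$$ for $i=0,\dots,\tau$ $$x_i=l^{\{\log_l x\}}\,l^{\,i+j},\qquad \kappa_i=F_i(x_i,\,l+1),$$ and for $m=0,\dots,\tau$ $$v_m=\sum_{i=m}^{\tau}\kappa_i\,s(i,m)\,\frac{1}{i!}.$$ Then $F_{t-j}(x,l)=P_\tau(t-j)$, where $P_\tau$ is a polynomial of degree $\tau$ in $t-j$ given by $$P_\tau(t-j)=\sum_{m=0}^{\tau}v_m\,(t-j)^m.$$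
   Context: For integers $n\ge1$, $k\ge 1$, $l\ge 1$, $f_k(n,l)=\#\{(i_1,\dots,i_k)\in\mathbb{Z}^k : i_1,\dots,i_k\ge l,\ i_1\cdots i_k=n\}$ is the number of ordered factorizations of $n$ into exactly $k$ factors, each at least $l$. For $k=0$: $f_0(1,l)=1$ and $f_0(n,l)=0$ for $n\ge 2$. For real $y\ge 1$, $F_k(y,l)=\sum_{1\le n\le y} f_k(n,l)$; in particular $F_0(y,l)=1$ for $y\ge1$. $\lfloor y\rfloor$ and $\lceil y\rceil$ denote the usual floor and ceiling of $y$, and $\{y\}=y-\lfloor y\rfloor$ denotes the fractional part. $s(i,m)$ denotes the (signed) Stirling numbers of the first kind, i.e. $\binom{X}{i}=\frac1{i!}\sum_{m=0}^{i}s(i,m)X^m$.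
   Formalization: "Polynomial of degree τ" is read as degree at most τ, with degree exactly τ when κ_τ ≠ 0; exact degree fails in general, e.g. l=2, x=5, j=0 gives τ=1, κ_1=F_1(2.5,3)=0, so P_1 is the constant 1. *)

theory Defs
  imports Complex_Main "HOL-Combinatorics.Stirling" "HOL-Computational_Algebra.Polynomial"
begin

text \<open>
  The number of ordered factorizations of \<open>n\<close> into exactly \<open>k\<close> factors, each at least \<open>l\<close>.
  A \<open>k\<close>-tuple of integers is a list of length \<open>k\<close>; the empty list has product \<open>1\<close>, so the
  convention for \<open>k = 0\<close> needs no separate clause. The set is finite whenever \<open>n \<ge> 1\<close> and
  \<open>l \<ge> 1\<close>; only such arguments are of interest.
\<close>

definition ordered_fact :: "nat \<Rightarrow> int \<Rightarrow> int \<Rightarrow> nat" where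
  "ordered_fact k n l =
     card {is :: int list. length is = k \<and> (\<forall>i \<in> set is. l \<le> i) \<and> prod_list is = n}"

definition ordered_fact_sum :: "nat \<Rightarrow> real \<Rightarrow> int \<Rightarrow> nat" where
  "ordered_fact_sum k y l = (\<Sum>n = 1..\<lfloor>y\<rfloor>. ordered_fact k n l)"

text \<open>\<^const>\<open>stirling\<close> is the unsigned Stirling number of the first kind.\<close>

definition signed_stirling :: "nat \<Rightarrow> nat \<Rightarrow> int" where
  "signed_stirling i m = (- 1) ^ (i + m) * int (stirling i m)"

lemma ordered_fact_0: "ordered_fact 0 n l = (if n = 1 then 1 else 0)"
proof -
  have "{is :: int list. length is = 0 \<and> (\<forall>i \<in> set is. l \<le> i) \<and> prod_list is = n}
      = (if n = 1 then {[]} else {})"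
    by auto
  then show ?thesis
    by (simp add: ordered_fact_def)
qed

lemma gbinomial_signed_stirling:
  fixes X :: real
  shows "X gchoose i = (1 / fact i) * (\<Sum>m = 0..i. of_int (signed_stirling i m) * X ^ m)"
proof -
  have "X gchoose i = (- 1) ^ i * pochhammer (- X) i / fact i"
    by (rule gbinomial_pochhammer)
  also have "pochhammer (- X) i = (\<Sum>m\<le>i. of_nat (stirling i m) * (- X) ^ m)"
    by (rule stirling_pochhammer[symmetric])
  also have "(- 1) ^ i * \<dots> = (\<Sum>m = 0..i. of_int (signed_stirling i m) * X ^ m)"
    unfolding sum_distrib_left atLeast0AtMost
    by (intro sum.cong refl)
      (simp add: signed_stirling_def power_add power_minus[of X])
  finally show ?thesis
    by simp
qed

end

theory Submission
  imports Defs
begin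

text \<open>
  In a tuple of \<open>k\<close> factors, each at least \<open>l\<close>, let \<open>i\<close> be the number of factors exceeding \<open>l\<close>.
  There are \<open>k choose i\<close> choices for their positions, the other factors contribute \<open>l ^ (k - i)\<close>
  to the product, and so, with \<open>F\<close> standing for \<^const>\<open>ordered_fact_sum\<close>,
  \<open>F k y l = (\<Sum>i\<le>k. (k choose i) * F i (y / l ^ (k - i)) (l + 1))\<close>.
  This is \<open>ordered_fact_sum_binomial\<close>; it is proved by splitting off the first factor
  and applying Pascal's rule, which avoids any bookkeeping of positions.

  For \<open>k = t - j\<close> the number \<open>x / l ^ (k - i)\<close> is exactly \<open>l powr frac (log l x) * l ^ (i + j)\<close>.
  The smallest product of \<open>i\<close> factors is \<open>(l + 1) ^ i\<close>, which grows faster in \<open>i\<close> than this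
  bound; taking logarithms, the \<open>i\<close>-th summand vanishes once
  \<open>i > (frac (log l x) + j) * ln l / (ln (l + 1) - ln l)\<close>. Hence the sum may be
  cut at \<open>\<tau>\<close>, and expanding the binomial coefficients \<open>k choose i\<close> in powers of \<open>k\<close> by signed
  Stirling numbers \<open>s(i, m)\<close> yields the polynomial. Its coefficient at \<open>\<tau>\<close> is \<open>\<kappa> \<tau> / \<tau>!\<close>, since \<open>s(\<tau>, \<tau>) = 1\<close>.
\<close>

section \<open>Factorizations with bounded product\<close>

text \<open>The tuples counted by \<^const>\<open>ordered_fact_sum\<close>, with the product as a bound instead of
  a summation index. For \<open>l \<ge> 1\<close> the lower bound \<open>1\<close> on the product is automatic.\<close>

definition bounded_tuples :: "nat \<Rightarrow> real \<Rightarrow> int \<Rightarrow> int list set" where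
  "bounded_tuples k y l =
     {fs. length fs = k \<and> (\<forall>i \<in> set fs. l \<le> i) \<and> of_int (prod_list fs) \<le> y}"

lemma power_length_le_prod_list:
  fixes l :: int
  assumes "0 \<le> l" and "\<forall>i \<in> set fs. l \<le> i"
  shows "l ^ length fs \<le> prod_list fs"
  using assms(2)
proof (induction fs)
  case (Cons a fs)
  then show ?case
    using assms(1) by (auto intro!: mult_mono)
qed simp

lemma prod_list_ge_1:
  fixes l :: int
  assumes "1 \<le> l" and "\<forall>i \<in> set fs. l \<le> i"
  shows "1 \<le> prod_list fs"
  using power_length_le_prod_list[of l fs] one_le_power[of l "length fs"] assms by linarith

lemma member_le_prod_list:
  fixes fs :: "int list"
  assumes "\<forall>i \<in> set fs. 1 \<le> i" and "i \<in> set fs"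
  shows "i \<le> prod_list fs"
  using assms
proof (induction fs)
  case (Cons a fs)
  have *: "1 \<le> prod_list fs" "1 \<le> a"
    using prod_list_ge_1[of 1 fs] Cons.prems by auto
  have "i \<le> a \<or> i \<le> prod_list fs"
    using Cons by auto
  then show ?case
  proof
    assume "i \<le> a"
    also have "a * 1 \<le> a * prod_list fs"
      using * by (intro mult_left_mono) auto
    finally show ?thesis by simp
  next
    assume "i \<le> prod_list fs"
    also have "1 * prod_list fs \<le> a * prod_list fs"
      using * by (intro mult_right_mono) auto
    finally show ?thesis by simp
  qed
qed simp

lemma finite_bounded_tuples:
  assumes "1 \<le> l"
  shows "finite (bounded_tuples k y l)"
proof (rule finite_subset)
  show "bounded_tuples k y l \<subseteq> {fs. set fs \<subseteq> {l..\<lfloor>y\<rfloor>} \<and> length fs = k}"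
  proof
    fix fs
    assume "fs \<in> bounded_tuples k y l"
    then have fs: "length fs = k" "\<forall>i \<in> set fs. l \<le> i" "prod_list fs \<le> \<lfloor>y\<rfloor>"
      by (auto simp: bounded_tuples_def le_floor_iff)
    have "i \<le> prod_list fs" if "i \<in> set fs" for i
      using member_le_prod_list[OF _ that] fs(2) assms by fastforce
    with fs show "fs \<in> {fs. set fs \<subseteq> {l..\<lfloor>y\<rfloor>} \<and> length fs = k}"
      by fastforce
  qed
  show "finite {fs. set fs \<subseteq> {l..\<lfloor>y\<rfloor>} \<and> length fs = k}"
    by (rule finite_lists_length_eq) simp
qed

lemma ordered_fact_sum_eq_card:
  assumes "1 \<le> l"
  shows "ordered_fact_sum k y l = card (bounded_tuples k y l)"
proof -
  let ?A = "\<lambda>n. {fs :: int list. length fs = k \<and> (\<forall>i \<in> set fs. l \<le> i) \<and> prod_list fs = n}"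
  have eq: "bounded_tuples k y l = (\<Union>n\<in>{1..\<lfloor>y\<rfloor>}. ?A n)"
    using prod_list_ge_1[OF assms] by (auto simp: bounded_tuples_def le_floor_iff)
  have "finite (?A n)" if "n \<in> {1..\<lfloor>y\<rfloor>}" for n
    using that by (intro finite_subset[OF _ finite_bounded_tuples[OF assms, of k y]]) (auto simp: eq)
  then have "card (bounded_tuples k y l) = (\<Sum>n\<in>{1..\<lfloor>y\<rfloor>}. card (?A n))"
    unfolding eq by (intro card_UN_disjoint) auto
  then show ?thesis
    by (simp add: ordered_fact_sum_def ordered_fact_def)
qed

lemma bounded_tuples_eq_empty:
  assumes "0 \<le> l" and "y < of_int l ^ k"
  shows "bounded_tuples k y l = {}"
proof -
  have False if "fs \<in> bounded_tuples k y l" for fs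
  proof -
    have "l ^ k \<le> prod_list fs" and "of_int (prod_list fs) \<le> y"
      using that power_length_le_prod_list[OF assms(1), of fs]
      by (auto simp: bounded_tuples_def)
    then have "of_int (l ^ k) \<le> y"
      by (meson of_int_le_iff order_trans)
    with assms(2) show False by simp
  qed
  then show ?thesis by blast
qed

lemma ordered_fact_sum_eq_0:
  assumes "1 \<le> l" and "y < of_int l ^ k"
  shows "ordered_fact_sum k y l = 0"
  using assms by (simp add: ordered_fact_sum_eq_card bounded_tuples_eq_empty)

lemma ordered_fact_sum_0: "ordered_fact_sum 0 y l = (if 1 \<le> y then 1 else 0)"
  by (simp add: ordered_fact_sum_def ordered_fact_0 le_floor_iff)

section \<open>Separating the factors equal to the lower bound\<close>

text \<open>Splitting off the first factor. The summation bound \<open>N\<close> is left open above \<open>\<lfloor>y\<rfloor>\<close>, so that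
  sums belonging to different values of \<open>y\<close> can be given the same range.\<close>

lemma ordered_fact_sum_Suc:
  assumes l: "1 \<le> l" and N: "\<lfloor>y\<rfloor> \<le> N"
  shows "ordered_fact_sum (Suc k) y l = (\<Sum>a = l..N. ordered_fact_sum k (y / of_int a) l)"
proof -
  let ?T = "\<lambda>a. (#) a ` bounded_tuples k (y / of_int a) l"
  have eq: "bounded_tuples (Suc k) y l = (\<Union>a\<in>{l..N}. ?T a)"
  proof (intro equalityI subsetI)
    fix fs
    assume "fs \<in> bounded_tuples (Suc k) y l"
    then obtain a as where fs: "fs = a # as" and as: "length as = k" "\<forall>i \<in> set as. l \<le> i"
      and a: "l \<le> a" and le: "of_int (a * prod_list as) \<le> y"
      by (cases fs) (auto simp: bounded_tuples_def)
    have "a \<le> a * prod_list as"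
      using member_le_prod_list[of "a # as" a] as a l by fastforce
    also have "\<dots> \<le> N"
      using le N by linarith
    finally have "a \<in> {l..N}" using a by simp
    moreover have "as \<in> bounded_tuples k (y / of_int a) l"
      using as le a l by (simp add: bounded_tuples_def field_simps)
    ultimately show "fs \<in> (\<Union>a\<in>{l..N}. ?T a)"
      using fs by blast
  next
    fix fs
    assume "fs \<in> (\<Union>a\<in>{l..N}. ?T a)"
    then show "fs \<in> bounded_tuples (Suc k) y l"
      using l by (auto simp: bounded_tuples_def field_simps)
  qed
  have "card (bounded_tuples (Suc k) y l) = (\<Sum>a\<in>{l..N}. card (?T a))"
    unfolding eq using finite_bounded_tuples[OF l] by (intro card_UN_disjoint) auto
  also have "\<dots> = (\<Sum>a\<in>{l..N}. card (bounded_tuples k (y / of_int a) l))"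
    by (intro sum.cong refl card_image) simp
  finally show ?thesis
    using l by (simp add: ordered_fact_sum_eq_card)
qed

lemma ordered_fact_sum_binomial:
  assumes l: "1 \<le> l"
  shows "ordered_fact_sum k y l =
    (\<Sum>i\<le>k. (k choose i) * ordered_fact_sum i (y / of_int l ^ (k - i)) (l + 1))"
proof (cases "0 \<le> y")
  case True
  then show ?thesis
  proof (induction k arbitrary: y)
    case 0
    then show ?case by (simp add: ordered_fact_sum_0)
  next
    case (Suc k)
    let ?F = "\<lambda>i y. ordered_fact_sum i y (l + 1)"
    define N where "N = max l \<lfloor>y\<rfloor>"
    have N: "l \<le> N" "\<lfloor>y\<rfloor> \<le> N" by (auto simp: N_def)
    have larger: "(\<Sum>a = l + 1..N. ordered_fact_sum k (y / of_int a) l) =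
        (\<Sum>i\<le>k. (k choose i) * ?F (Suc i) (y / of_int l ^ (k - i)))"
    proof -
      have "(\<Sum>a = l + 1..N. ordered_fact_sum k (y / of_int a) l) =
          (\<Sum>a = l + 1..N. \<Sum>i\<le>k. (k choose i) * ?F i (y / of_int a / of_int l ^ (k - i)))"
        using l Suc.prems by (intro sum.cong refl Suc.IH) simp
      also have "\<dots> =
          (\<Sum>i\<le>k. (k choose i) * (\<Sum>a = l + 1..N. ?F i (y / of_int l ^ (k - i) / of_int a)))"
        by (subst sum.swap) (simp add: sum_distrib_left mult.commute)
      also have "\<dots> = (\<Sum>i\<le>k. (k choose i) * ?F (Suc i) (y / of_int l ^ (k - i)))"
      proof (rule sum.cong)
        fix i
        have "y / of_int l ^ (k - i) \<le> y"
          using Suc.prems l by (simp add: divide_le_eq mult_left_le one_le_power mult_le_cancel_left1)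
        then have "\<lfloor>y / of_int l ^ (k - i)\<rfloor> \<le> N"
          using N(2) floor_mono order_trans by blast
        then show "(k choose i) * (\<Sum>a = l + 1..N. ?F i (y / of_int l ^ (k - i) / of_int a)) =
            (k choose i) * ?F (Suc i) (y / of_int l ^ (k - i))"
          using l by (subst ordered_fact_sum_Suc[where N = N]) auto
      qed simp
      finally show ?thesis .
    qed
    have equal: "ordered_fact_sum k (y / of_int l) l =
        (\<Sum>i\<le>k. (k choose i) * ?F i (y / of_int l ^ (Suc k - i)))"
      using Suc.IH[of "y / of_int l"] Suc.prems l
      by (simp add: Suc_diff_le)
    have "ordered_fact_sum (Suc k) y l =
        ordered_fact_sum k (y / of_int l) l + (\<Sum>a = l + 1..N. ordered_fact_sum k (y / of_int a) l)"
    proof -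
      have "{l..N} = insert l {l + 1..N}" using N(1) by auto
      then show ?thesis
        by (simp add: ordered_fact_sum_Suc[OF l N(2)])
    qed
    also have "\<dots> = (\<Sum>i\<le>Suc k. (k choose i) * ?F i (y / of_int l ^ (Suc k - i))) +
        (\<Sum>i\<le>k. (k choose i) * ?F (Suc i) (y / of_int l ^ (k - i)))"
      unfolding equal larger by simp
    \<comment> \<open>Shifting the index in the first sum lets Pascal's rule combine the two.\<close>
    also have "\<dots> = (\<Sum>i\<le>Suc k. (Suc k choose i) * ?F i (y / of_int l ^ (Suc k - i)))"
      unfolding sum.atMost_Suc_shift by (simp add: sum.distrib add_mult_distrib)
    finally show ?case .
  qed
next
  case False
  \<comment> \<open>A negative bound makes the range of summation in every \<^const>\<open>ordered_fact_sum\<close> empty.\<close>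
  have "ordered_fact_sum m z b = 0" if "z < 0" for m z b
    using that by (simp add: ordered_fact_sum_def)
  moreover have "y / of_int l ^ m < 0" for m
    using False l by (simp add: divide_neg_pos)
  ultimately show ?thesis
    using False by simp
qed

section \<open>The polynomial in the number of factors\<close>

theorem theorem3p1:
  fixes x :: real and l :: int and t j \<tau> :: nat
    and xs \<kappa> v :: "nat \<Rightarrow> real" and P :: "real poly"
  assumes "x \<ge> 1" and "l \<ge> 2"
    and "t = nat \<lfloor>log l x\<rfloor>"
    and "j < t"
    and "\<tau> = min (t - j)
           (nat \<lceil>(frac (log l x) * ln l + real j * ln l) / (ln (l + 1) - ln l)\<rceil>)"
    and "\<forall>i \<in> {0..\<tau>}. xs i = l powr frac (log l x) * l ^ (i + j)"
    and "\<forall>i \<in> {0..\<tau>}. \<kappa> i = real (ordered_fact_sum i (xs i) (l + 1))"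
    and "\<forall>m \<in> {0..\<tau>}. v m = (\<Sum>i = m..\<tau>. \<kappa> i * signed_stirling i m * (1 / fact i))"
    and "P = (\<Sum>m = 0..\<tau>. monom (v m) m)"
  shows "real (ordered_fact_sum (t - j) x l) = poly P (real (t - j))
       \<and> poly P (real (t - j)) = (\<Sum>m = 0..\<tau>. v m * real (t - j) ^ m)
       \<and> degree P \<le> \<tau>
       \<and> (\<kappa> \<tau> \<noteq> 0 \<longrightarrow> degree P = \<tau>)"
proof -
  define k where "k = t - j"
  define L where "L = real_of_int l"
  define q where "q = (frac (log L x) * ln L + real j * ln L) / (ln (L + 1) - ln L)"
  define z where "z = (\<lambda>i. L powr frac (log L x) * L ^ (i + j))"
  have L: "L \<ge> 2" using assms(2) by (simp add: L_def)
  have \<tau>: "\<tau> = min k (nat \<lceil>q\<rceil>)"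
    using assms(5) by (simp add: k_def q_def L_def)
  have \<kappa>: "\<kappa> i = real (ordered_fact_sum i (z i) (l + 1))" if "i \<le> \<tau>" for i
    using assms(6,7) that by (simp add: z_def L_def)

  have "x = L powr (log L x)"
    using L assms(1) by simp
  also have "log L x = frac (log L x) + real t"
    using L assms(1,3) by (simp add: frac_def L_def)
  also have "L powr \<dots> = L powr frac (log L x) * L ^ t"
    using L by (simp add: powr_add powr_realpow)
  finally have x: "x = L powr frac (log L x) * L ^ t" .
  have x_div: "x / L ^ (k - i) = z i" if "i \<le> k" for i
  proof -
    have "t = (i + j) + (k - i)"
      using that assms(4) by (simp add: k_def)
    then have "L ^ t = L ^ (i + j) * L ^ (k - i)"
      by (metis power_add)
    then show ?thesis
      using L by (subst x) (simp add: z_def)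
  qed

  \<comment> \<open>If \<open>\<tau> < i \<le> k\<close>, then the minimum defining \<open>\<tau>\<close> is attained by the ceiling of \<open>q\<close>.\<close>
  have vanish: "ordered_fact_sum i (z i) (l + 1) = 0" if "\<tau> < i" "i \<le> k" for i
  proof -
    have "q < real i"
      using that \<tau> by linarith
    moreover have "0 < ln (L + 1) - ln L"
      using L by simp
    ultimately have "frac (log L x) * ln L + real j * ln L < real i * (ln (L + 1) - ln L)"
      by (simp add: q_def pos_divide_less_eq)
    then have "frac (log L x) * ln L + real (i + j) * ln L < real i * ln (L + 1)"
      by (simp add: algebra_simps)
    moreover have "ln (z i) = frac (log L x) * ln L + real (i + j) * ln L"
      using L by (simp add: z_def ln_mult ln_powr ln_realpow)
    moreover have "ln ((L + 1) ^ i) = real i * ln (L + 1)"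
      using L by (simp add: ln_realpow)
    ultimately have "ln (z i) < ln ((L + 1) ^ i)"
      by simp
    moreover have "0 < z i" "0 < (L + 1) ^ i"
      using L by (auto simp: z_def)
    ultimately have "z i < of_int (l + 1) ^ i"
      by (simp add: L_def)
    then show ?thesis
      using assms(2) by (intro ordered_fact_sum_eq_0) auto
  qed

  have poly: "poly P (real k) = (\<Sum>m = 0..\<tau>. v m * real k ^ m)"
    by (simp add: assms(9) poly_sum poly_monom)

  have "real (ordered_fact_sum k x l) =
      (\<Sum>i\<le>k. real (k choose i) * real (ordered_fact_sum i (z i) (l + 1)))"
    using assms(2) x_div by (subst ordered_fact_sum_binomial) (auto simp: L_def)
  also have "\<dots> = (\<Sum>i\<le>\<tau>. real (k choose i) * real (ordered_fact_sum i (z i) (l + 1)))"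
  proof (rule sum.mono_neutral_right)
    show "{..\<tau>} \<subseteq> {..k}" using \<tau> by simp
  qed (use vanish in auto)
  also have "\<dots> = (\<Sum>i\<le>\<tau>. \<Sum>m\<le>i. \<kappa> i * signed_stirling i m * (1 / fact i) * real k ^ m)"
  proof (intro sum.cong refl)
    fix i
    assume "i \<in> {..\<tau>}"
    then show "real (k choose i) * real (ordered_fact_sum i (z i) (l + 1)) =
        (\<Sum>m\<le>i. \<kappa> i * signed_stirling i m * (1 / fact i) * real k ^ m)"
      using gbinomial_signed_stirling[of "real k" i]
      by (simp add: \<kappa> binomial_gbinomial sum_distrib_left atLeast0AtMost mult_ac)
  qed
  also have "\<dots> = (\<Sum>m\<le>\<tau>. \<Sum>i = m..\<tau>. \<kappa> i * signed_stirling i m * (1 / fact i) * real k ^ m)"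
  proof -
    let ?g = "\<lambda>i m. \<kappa> i * signed_stirling i m * (1 / fact i) * real k ^ m"
    have "(\<Sum>i\<le>\<tau>. \<Sum>m\<le>i. ?g i m) = (\<Sum>i\<le>\<tau>. \<Sum>m | m \<in> {..\<tau>} \<and> m \<le> i. ?g i m)"
      by (intro sum.cong refl) auto
    also have "\<dots> = (\<Sum>m\<le>\<tau>. \<Sum>i | i \<in> {..\<tau>} \<and> m \<le> i. ?g i m)"
      by (rule sum.swap_restrict) auto
    also have "\<dots> = (\<Sum>m\<le>\<tau>. \<Sum>i = m..\<tau>. ?g i m)"
      by (intro sum.cong refl) auto
    finally show ?thesis .
  qed
  also have "\<dots> = (\<Sum>m = 0..\<tau>. v m * real k ^ m)"
    using assms(8) by (simp add: sum_distrib_right atLeast0AtMost)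
  finally have count: "real (ordered_fact_sum k x l) = poly P (real k)"
    by (simp add: poly)

  have degree: "degree P \<le> \<tau>"
    unfolding assms(9) by (intro degree_sum_le) (auto intro: order_trans[OF degree_monom_le])
  moreover have "degree P = \<tau>" if "\<kappa> \<tau> \<noteq> 0"
  proof -
    have "coeff P \<tau> = v \<tau>"
      by (simp add: assms(9) coeff_sum)
    also have "\<dots> = \<kappa> \<tau> * (1 / fact \<tau>)"
      using assms(8) by (simp add: signed_stirling_def)
    finally have "coeff P \<tau> \<noteq> 0"
      using that by simp
    then show ?thesis
      using degree le_degree by (metis order_antisym)
  qed
  ultimately show ?thesis
    using count poly by (simp add: k_def)
qed

end
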